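(* Let $A$ be a finite set of agents with $|A|\ge 2$ and $\mathsf{Prop}$ a countable set of propositional variables. For every formula $\varphi\in\mathcal{L}_{KS}$: if $\varphi$ is valid on the class of all simplicial secrecy models (true at every facet of every simplicial secrecy model), then $\vdash_{\mathsf{SSL}}\varphi$.
   Context: A simplicial complex is a pair $(V,\mathcal{F})$ with $V$ a non-empty set and $\mathcal{F}$ a non-empty family of finite non-empty subsets of $V$ (faces), closed under non-empty subsets. A facet is an inclusion-maximal face; $\mathrm{Fac}$ denotes the set of facets. An $A$-chromatic simplicial complex is $(V,\mathcal{F},\chi)$ with $\chi:V\to A$ injective on every face. An $A$-chromatic simplicial epistemic model is $(V,\mathcal{F},\chi,\nu)$ where $(V,\mathcal{F},\chi)$ is $A$-chromatic, every facet $X$ satisfies $\chi[X]=A$, every vertex lies in some facet, and $\nu:\mathrm{Fac}\to\mathcal{P}(\mathsf{Prop})$. For a facet $X$ and $a\in A$, $v_a(X)$ is the unique vertex of colour $a$ in $X$; for a vertex $v$, $\mathrm{St}(v)=\{X\in\mathrm{Fac}: v\in X\}$; $X\sim_a Y$ iff $v_a(X)=v_a(Y)$. A simplicial secrecy model is $M=(V,\mathcal{F},\chi,\nu,\{N^S_a\}_{a\in A})$ where $(V,\mathcal{F},\chi,\nu)$ is such a model and, with $V_a=\{v:\chi(v)=a\}$, each $N_a^S:V_a\to\mathcal{P}(\mathcal{P}(\mathrm{Fac}(M)))$ satisfies (SN): for every $a$, $v\in V_a$, $U\in N_a^S(v)$, every $X\in\mathrm{St}(v)$ and every $b\in A\setminus\{a\}$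 there is a facet $Y$ with $X\sim_b Y$ and $Y\notin U$. The language $\mathcal{L}_{KS}$ is $\varphi::=p\mid\neg\varphi\mid(\varphi\wedge\varphi)\mid K_a\varphi\mid S_a\varphi$ ($p\in\mathsf{Prop}$, $a\in A$). Truth at facets: $M,X\Vdash p$ iff $p\in\nu(X)$; Boolean clauses as usual; $M,X\Vdash K_a\varphi$ iff $M,Y\Vdash\varphi$ for all facets $Y$ with $X\sim_a Y$; $M,X\Vdash S_a\varphi$ iff $M,X\Vdash K_a\varphi$ and $[\![\varphi]\!]\in N_a^S(v_a(X))$, where $[\![\varphi]\!]=\{Y\in\mathrm{Fac}(M):M,Y\Vdash\varphi\}$. The system $\mathsf{SSL}$ has axioms: all propositional tautologies; for each $a\in A$: (K) $K_a(\varphi\to\psi)\to(K_a\varphi\to K_a\psi)$, (T) $K_a\varphi\to\varphi$, (4) $K_a\varphi\to K_aK_a\varphi$, (5) $\neg K_a\varphi\to K_a\neg K_a\varphi$, (S1) $S_a\varphi\to K_a\varphi$, (S4) $S_a\varphi\to K_aS_a\varphi$; and for distinct $a,b\in A$: (S2) $S_a\varphi\to\neg K_b\varphi$. Rules: modus ponens; from $\varphi$ infer $K_a\varphi$; from $\vdash\varphi\leftrightarrow\psi$ infer $\vdash S_a\varphi\leftrightarrow S_a\psi$. *)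

theory Defs
  imports Main "HOL-Library.Countable" "HOL-Library.Cardinality"
begin

section \<open>Simplicial models\<close>

definition simplicial_complex :: "'v set \<Rightarrow> 'v set set \<Rightarrow> bool" where
  "simplicial_complex V F \<longleftrightarrow>
     V \<noteq> {} \<and> F \<noteq> {} \<and>
     (\<forall>X\<in>F. finite X \<and> X \<noteq> {} \<and> X \<subseteq> V) \<and>
     (\<forall>X\<in>F. \<forall>Y. Y \<noteq> {} \<and> Y \<subseteq> X \<longrightarrow> Y \<in> F)"

definition facets :: "'v set set \<Rightarrow> 'v set set" where
  "facets F = {X \<in> F. \<forall>Y\<in>F. X \<subseteq> Y \<longrightarrow> Y = X}"

definition chromatic_complex :: "'v set \<Rightarrow> 'v set set \<Rightarrow> ('v \<Rightarrow> 'a) \<Rightarrow> bool" where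
  "chromatic_complex V F \<chi> \<longleftrightarrow> simplicial_complex V F \<and> (\<forall>X\<in>F. inj_on \<chi> X)"

text \<open>
  The set of agents is the whole type \<^typ>\<open>'a\<close> and the set of propositional variables is the
  whole type \<^typ>\<open>'p\<close>. The components \<open>colour\<close>, \<open>val\<close> and \<open>nbh\<close> are total functions;
  only the values of \<open>colour\<close> on vertices, of \<open>val\<close> on facets, and of \<open>nbh a\<close> on vertices
  of colour \<open>a\<close> are relevant.
\<close>

record ('v, 'a, 'p) secrecy_structure =
  verts :: "'v set"
  faces :: "'v set set"
  colour :: "'v \<Rightarrow> 'a"
  val :: "'v set \<Rightarrow> 'p set"
  nbh :: "'a \<Rightarrow> 'v \<Rightarrow> 'v set set set"

definition Fac :: "('v, 'a, 'p) secrecy_structure \<Rightarrow> 'v set set" where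
  "Fac M = facets (faces M)"

definition epistemic_model :: "('v, 'a, 'p) secrecy_structure \<Rightarrow> bool" where
  "epistemic_model M \<longleftrightarrow>
     chromatic_complex (verts M) (faces M) (colour M) \<and>
     (\<forall>X\<in>Fac M. colour M ` X = UNIV) \<and>
     (\<forall>v\<in>verts M. \<exists>X\<in>Fac M. v \<in> X)"

definition vertex_of :: "('v, 'a, 'p) secrecy_structure \<Rightarrow> 'a \<Rightarrow> 'v set \<Rightarrow> 'v" where
  "vertex_of M a X = (THE v. v \<in> X \<and> colour M v = a)"

definition star :: "('v, 'a, 'p) secrecy_structure \<Rightarrow> 'v \<Rightarrow> 'v set set" where
  "star M v = {X \<in> Fac M. v \<in> X}"

definition indist :: "('v, 'a, 'p) secrecy_structure \<Rightarrow> 'a \<Rightarrow> 'v set \<Rightarrow> 'v set \<Rightarrow> bool" where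
  "indist M a X Y \<longleftrightarrow> vertex_of M a X = vertex_of M a Y"

definition verts_of_colour :: "('v, 'a, 'p) secrecy_structure \<Rightarrow> 'a \<Rightarrow> 'v set" where
  "verts_of_colour M a = {v \<in> verts M. colour M v = a}"

definition secrecy_model :: "('v, 'a, 'p) secrecy_structure \<Rightarrow> bool" where
  "secrecy_model M \<longleftrightarrow>
     epistemic_model M \<and>
     (\<forall>a. \<forall>v\<in>verts_of_colour M a. nbh M a v \<subseteq> Pow (Fac M)) \<and>
     (\<forall>a. \<forall>v\<in>verts_of_colour M a. \<forall>U\<in>nbh M a v. \<forall>X\<in>star M v. \<forall>b. b \<noteq> a \<longrightarrow>
        (\<exists>Y\<in>Fac M. indist M b X Y \<and> Y \<notin> U))"


section \<open>Language and semantics\<close>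

datatype ('a, 'p) form =
    Atom 'p
  | Neg "('a, 'p) form"
  | Conj "('a, 'p) form" "('a, 'p) form"
  | Know 'a "('a, 'p) form"
  | Secret 'a "('a, 'p) form"

abbreviation Imp :: "('a, 'p) form \<Rightarrow> ('a, 'p) form \<Rightarrow> ('a, 'p) form" where
  "Imp \<phi> \<psi> \<equiv> Neg (Conj \<phi> (Neg \<psi>))"

abbreviation Iff :: "('a, 'p) form \<Rightarrow> ('a, 'p) form \<Rightarrow> ('a, 'p) form" where
  "Iff \<phi> \<psi> \<equiv> Conj (Imp \<phi> \<psi>) (Imp \<psi> \<phi>)"

text \<open>
  In the clause for \<open>Secret\<close> the first conjunct is the truth condition of \<open>Know a \<phi>\<close>,
  written out to keep the recursion structural.
\<close>

primrec sat :: "('v, 'a, 'p) secrecy_structure \<Rightarrow> 'v set \<Rightarrow> ('a, 'p) form \<Rightarrow> bool" where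
  "sat M X (Atom p) \<longleftrightarrow> p \<in> val M X"
| "sat M X (Neg \<phi>) \<longleftrightarrow> \<not> sat M X \<phi>"
| "sat M X (Conj \<phi> \<psi>) \<longleftrightarrow> sat M X \<phi> \<and> sat M X \<psi>"
| "sat M X (Know a \<phi>) \<longleftrightarrow> (\<forall>Y\<in>Fac M. indist M a X Y \<longrightarrow> sat M Y \<phi>)"
| "sat M X (Secret a \<phi>) \<longleftrightarrow>
     (\<forall>Y\<in>Fac M. indist M a X Y \<longrightarrow> sat M Y \<phi>) \<and>
     {Y \<in> Fac M. sat M Y \<phi>} \<in> nbh M a (vertex_of M a X)"


section \<open>The system SSL\<close>

text \<open>
  Propositional tautologies of the modal language: formulas true under every Boolean valuation
  that treats propositional variables and modal formulas as atoms.
\<close>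

primrec bool_eval :: "(('a, 'p) form \<Rightarrow> bool) \<Rightarrow> ('a, 'p) form \<Rightarrow> bool" where
  "bool_eval h (Atom p) \<longleftrightarrow> h (Atom p)"
| "bool_eval h (Neg \<phi>) \<longleftrightarrow> \<not> bool_eval h \<phi>"
| "bool_eval h (Conj \<phi> \<psi>) \<longleftrightarrow> bool_eval h \<phi> \<and> bool_eval h \<psi>"
| "bool_eval h (Know a \<phi>) \<longleftrightarrow> h (Know a \<phi>)"
| "bool_eval h (Secret a \<phi>) \<longleftrightarrow> h (Secret a \<phi>)"

definition tautology :: "('a, 'p) form \<Rightarrow> bool" where
  "tautology \<phi> \<longleftrightarrow> (\<forall>h. bool_eval h \<phi>)"

inductive SSL :: "('a, 'p) form \<Rightarrow> bool" where
  Taut: "tautology \<phi> \<Longrightarrow> SSL \<phi>"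
| AxK: "SSL (Imp (Know a (Imp \<phi> \<psi>)) (Imp (Know a \<phi>) (Know a \<psi>)))"
| AxT: "SSL (Imp (Know a \<phi>) \<phi>)"
| Ax4: "SSL (Imp (Know a \<phi>) (Know a (Know a \<phi>)))"
| Ax5: "SSL (Imp (Neg (Know a \<phi>)) (Know a (Neg (Know a \<phi>))))"
| AxS1: "SSL (Imp (Secret a \<phi>) (Know a \<phi>))"
| AxS2: "a \<noteq> b \<Longrightarrow> SSL (Imp (Secret a \<phi>) (Neg (Know b \<phi>)))"
| AxS4: "SSL (Imp (Secret a \<phi>) (Know a (Secret a \<phi>)))"
| MP: "SSL \<phi> \<Longrightarrow> SSL (Imp \<phi> \<psi>) \<Longrightarrow> SSL \<psi>"
| Nec: "SSL \<phi> \<Longrightarrow> SSL (Know a \<phi>)"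
| RE: "SSL (Iff \<phi> \<psi>) \<Longrightarrow> SSL (Iff (Secret a \<phi>) (Secret a \<psi>))"

end

theory Submission
  imports Defs "HOL-Library.Countable_Set"
begin

text \<open>
  If \<open>\<phi>\<close> is not derivable, filter the canonical model through the finite set \<open>closure \<phi>\<close>: the
  worlds are the traces \<open>\<Gamma> \<inter> closure \<phi>\<close> of maximal consistent sets, agent \<open>a\<close> observes the
  \<open>Know a\<close>- and \<open>Secret a\<close>-formulas of a world, and the neighbourhoods are the truth sets of the
  formulas declared secret. This frame need not be simplicial, since distinct worlds may be
  indistinguishable for all agents. Enumerate the worlds by an injection \<open>i\<close> into the
  integers and attach a counter \<open>g\<close> to every world. All agents observe \<open>g\<close>, except one agent
  who observes \<open>g + i w\<close> instead. Every step between worlds lifts to the copies, and since there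
  are two agents, all of them together determine \<open>(w, g)\<close>. The pairs are then the facets of a
  countable simplicial secrecy model.
\<close>

section \<open>Simplicial models from frames\<close>

text \<open>Worlds are primitive points here, and \<open>obs a x\<close> plays the vertex of colour
  \<open>a\<close> of the facet belonging to \<open>x\<close>. The truth lemma can thus be proved
  without mentioning simplices.\<close>

primrec frame_sat ::
  "'w set \<Rightarrow> ('a \<Rightarrow> 'w \<Rightarrow> 'v) \<Rightarrow> ('w \<Rightarrow> 'p set) \<Rightarrow> ('a \<Rightarrow> 'w \<Rightarrow> 'w set set) \<Rightarrow>
    'w \<Rightarrow> ('a, 'p) form \<Rightarrow> bool" where
  "frame_sat W obs V N x (Atom p) \<longleftrightarrow> p \<in> V x"
| "frame_sat W obs V N x (Neg \<phi>) \<longleftrightarrow> \<not> frame_sat W obs V N x \<phi>"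
| "frame_sat W obs V N x (Conj \<phi> \<psi>) \<longleftrightarrow> frame_sat W obs V N x \<phi> \<and> frame_sat W obs V N x \<psi>"
| "frame_sat W obs V N x (Know a \<phi>) \<longleftrightarrow>
     (\<forall>y\<in>W. obs a x = obs a y \<longrightarrow> frame_sat W obs V N y \<phi>)"
| "frame_sat W obs V N x (Secret a \<phi>) \<longleftrightarrow>
     (\<forall>y\<in>W. obs a x = obs a y \<longrightarrow> frame_sat W obs V N y \<phi>) \<and>
     {y \<in> W. frame_sat W obs V N y \<phi>} \<in> N a x"

text \<open>These conditions let each world become a facet: \<open>obs_agent\<close> makes colours
  well defined, \<open>obs_separates\<close> keeps the facets of distinct worlds distinct,
  \<open>N_cong\<close> lets a neighbourhood family depend on the vertex alone, and
  \<open>N_secret\<close> becomes (SN). Finiteness of the agent type makes facets finite.\<close>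

locale secrecy_frame =
  fixes W :: "'w set"
    and obs :: "'a::finite \<Rightarrow> 'w \<Rightarrow> 'v"
    and V :: "'w \<Rightarrow> 'p set"
    and N :: "'a \<Rightarrow> 'w \<Rightarrow> 'w set set"
  assumes nonempty: "W \<noteq> {}"
    and obs_agent: "\<lbrakk>x \<in> W; y \<in> W; obs a x = obs b y\<rbrakk> \<Longrightarrow> a = b"
    and obs_separates: "\<lbrakk>x \<in> W; y \<in> W; \<And>a. obs a x = obs a y\<rbrakk> \<Longrightarrow> x = y"
    and N_subset: "\<lbrakk>x \<in> W; U \<in> N a x\<rbrakk> \<Longrightarrow> U \<subseteq> W"
    and N_cong: "\<lbrakk>x \<in> W; y \<in> W; obs a x = obs a y\<rbrakk> \<Longrightarrow> N a x = N a y"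
    and N_secret: "\<lbrakk>x \<in> W; U \<in> N a x; b \<noteq> a\<rbrakk> \<Longrightarrow> \<exists>y\<in>W. obs b x = obs b y \<and> y \<notin> U"
begin

definition facet :: "'w \<Rightarrow> 'v set" where
  "facet x = range (\<lambda>a. obs a x)"

text \<open>Vertices and facets carry no data of their own, so each component is recovered from the
  worlds: \<open>colour\<close> through \<open>obs_agent\<close>, \<open>val\<close> through
  injectivity of \<open>facet\<close>, and \<open>nbh\<close> by collecting over all worlds that
  share the vertex.\<close>

definition model :: "('v, 'a, 'p) secrecy_structure" where
  "model =
    \<lparr>verts = \<Union> (facet ` W),
     faces = {Y. Y \<noteq> {} \<and> (\<exists>x\<in>W. Y \<subseteq> facet x)},
     colour = (\<lambda>v. THE a. \<exists>x\<in>W. obs a x = v),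
     val = (\<lambda>X. V (the_inv_into W facet X)),
     nbh = (\<lambda>a v. {facet ` U |U x. x \<in> W \<and> obs a x = v \<and> U \<in> N a x})\<rparr>"

lemma colour_obs: "x \<in> W \<Longrightarrow> colour model (obs a x) = a"
  unfolding model_def by (auto dest: obs_agent)

text \<open>A vertex determines its agent, so the vertex of \<open>a\<close> in
  \<open>facet x\<close> can only match the vertex of \<open>a\<close> in \<open>facet y\<close>.
  Having inclusion as premise yields both maximality and injectivity.\<close>

lemma facet_eqI:
  assumes "x \<in> W" "y \<in> W" "facet x \<subseteq> facet y"
  shows "x = y"
proof (rule obs_separates[OF assms(1,2)])
  fix a
  obtain b where "obs a x = obs b y"
    using assms(3) unfolding facet_def by blast
  then show "obs a x = obs a y"
    using obs_agent assms(1,2) by blast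
qed

lemma inj_on_facet: "inj_on facet W"
  by (auto intro!: inj_onI facet_eqI)

lemma Fac_model: "Fac model = facet ` W"
proof
  show "Fac model \<subseteq> facet ` W"
  proof
    fix X assume "X \<in> Fac model"
    then have X: "X \<in> faces model" "\<And>Y. Y \<in> faces model \<Longrightarrow> X \<subseteq> Y \<Longrightarrow> Y = X"
      unfolding Fac_def facets_def by auto
    then obtain x where x: "x \<in> W" "X \<subseteq> facet x"
      unfolding model_def by auto
    then have "facet x \<in> faces model"
      unfolding model_def facet_def by auto
    then show "X \<in> facet ` W"
      using X(2) x by blast
  qed
  show "facet ` W \<subseteq> Fac model"
  proof
    fix X assume "X \<in> facet ` W"
    then obtain x where x: "x \<in> W" "X = facet x" by blast
    have "X \<in> faces model"
      using x unfolding model_def facet_def by auto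
    moreover have "Y = X" if "Y \<in> faces model" "X \<subseteq> Y" for Y
    proof -
      from that(1) obtain y where y: "y \<in> W" "Y \<subseteq> facet y"
        unfolding model_def by auto
      then have "x = y"
        using facet_eqI x that(2) by blast
      then show ?thesis using x y that(2) by blast
    qed
    ultimately show "X \<in> Fac model"
      unfolding Fac_def facets_def by blast
  qed
qed

lemma vertex_of_facet: "x \<in> W \<Longrightarrow> vertex_of model a (facet x) = obs a x"
  unfolding vertex_of_def by (rule the_equality) (auto simp: facet_def colour_obs)

lemma epistemic_model: "epistemic_model model"
proof -
  have inj: "inj_on (colour model) (facet x)" if "x \<in> W" for x
    using that unfolding facet_def by (auto intro!: inj_onI simp: colour_obs)
  have "simplicial_complex (verts model) (faces model)"
    unfolding simplicial_complex_def
  proof (intro conjI ballI allI impI)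
    obtain x where "x \<in> W" using nonempty by blast
    then show "verts model \<noteq> {}" "faces model \<noteq> {}"
      unfolding model_def facet_def by auto
  next
    fix X assume "X \<in> faces model"
    then show "finite X" "X \<noteq> {}" "X \<subseteq> verts model"
      unfolding model_def facet_def by (auto intro: finite_subset)
  next
    fix X Y assume "X \<in> faces model" "Y \<noteq> {} \<and> Y \<subseteq> X"
    then show "Y \<in> faces model"
      unfolding model_def using subset_trans[of Y X] by fastforce
  qed
  moreover have "inj_on (colour model) X" if "X \<in> faces model" for X
  proof -
    from that obtain x where "x \<in> W" "X \<subseteq> facet x"
      unfolding model_def by auto
    then show ?thesis using inj inj_on_subset by blast
  qed
  moreover have "colour model ` facet x = UNIV" if "x \<in> W" for x
    using that unfolding facet_def by (simp add: image_image colour_obs)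
  moreover have "\<exists>X\<in>Fac model. v \<in> X" if "v \<in> verts model" for v
    using that unfolding Fac_model by (auto simp: model_def)
  ultimately show ?thesis
    unfolding epistemic_model_def chromatic_complex_def Fac_model by simp
qed

text \<open>By \<open>N_cong\<close>, all worlds sharing the vertex contribute the same family, so a
  single representative suffices.\<close>

lemma nbh_obs:
  assumes "x \<in> W"
  shows "nbh model a (obs a x) = (`) facet ` N a x"
proof -
  have "nbh model a (obs a x) = {facet ` U |U y. y \<in> W \<and> obs a y = obs a x \<and> U \<in> N a y}"
    by (simp add: model_def)
  also have "\<dots> = {facet ` U |U. U \<in> N a x}"
  proof (intro Collect_cong ex_cong1 iffI)
    fix X U assume "\<exists>y. X = facet ` U \<and> y \<in> W \<and> obs a y = obs a x \<and> U \<in> N a y"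
    then obtain y where "X = facet ` U" "y \<in> W" "obs a y = obs a x" "U \<in> N a y" by blast
    then show "X = facet ` U \<and> U \<in> N a x"
      using N_cong[OF _ assms] by simp
  qed (use assms in blast)
  finally show ?thesis by (simp only: Setcompr_eq_image Collect_mem_eq)
qed

lemma secrecy_model: "secrecy_model model"
proof -
  have vert: "\<exists>x\<in>W. v = obs a x" if "v \<in> verts_of_colour model a" for v a
  proof -
    from that obtain x b where "x \<in> W" "v = obs b x"
      by (auto simp: verts_of_colour_def model_def facet_def)
    then show ?thesis
      using that colour_obs[of x b] by (auto simp: verts_of_colour_def)
  qed
  have "nbh model a v \<subseteq> Pow (Fac model)" if "v \<in> verts_of_colour model a" for a v
    using vert[OF that] N_subset by (fastforce simp: nbh_obs Fac_model)
  moreover have "\<exists>Y\<in>Fac model. indist model b X Y \<and> Y \<notin> U"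
    if v: "v \<in> verts_of_colour model a" and U: "U \<in> nbh model a v"
      and X: "X \<in> star model v" and "b \<noteq> a" for a v U X b
  proof -
    obtain y where y: "y \<in> W" "X = facet y" "v \<in> facet y"
      using X by (auto simp: star_def Fac_model)
    then have vy: "v = obs a y"
      using v by (auto simp: facet_def verts_of_colour_def colour_obs)
    obtain U' where U': "U' \<in> N a y" "U = facet ` U'"
      using U y unfolding vy nbh_obs[OF y(1)] by blast
    obtain z where z: "z \<in> W" "obs b y = obs b z" "z \<notin> U'"
      using N_secret y(1) U'(1) \<open>b \<noteq> a\<close> by blast
    \<comment> \<open>\<open>U'\<close> consists of worlds only and \<open>facet\<close> is
      injective on them, so no other world can bring \<open>facet z\<close> into the image.\<close>
    have "facet z \<notin> U"
      using z U' N_subset[OF y(1) U'(1)] inj_on_facet by (auto dest: inj_onD)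
    then show ?thesis
      using z y by (auto simp: Fac_model indist_def vertex_of_facet)
  qed
  ultimately show ?thesis
    unfolding secrecy_model_def using epistemic_model by blast
qed

text \<open>\<open>facet\<close> is a bijection from \<open>W\<close> onto the facets that respects
  observation. In the \<open>Secret\<close> case its image map must also be injective on subsets of
  \<open>W\<close>, so that membership in \<open>N\<close> is reflected and not only
  preserved.\<close>

lemma sat_model: "x \<in> W \<Longrightarrow> sat model (facet x) \<phi> \<longleftrightarrow> frame_sat W obs V N x \<phi>"
proof (induction \<phi> arbitrary: x)
  case (Atom p)
  then show ?case
    by (simp add: model_def the_inv_into_f_f inj_on_facet)
next
  case (Know a \<phi>)
  then show ?case
    by (simp add: Fac_model indist_def vertex_of_facet)
next
  case (Secret a \<phi>)
  have "{Y \<in> Fac model. sat model Y \<phi>} = facet ` {y \<in> W. frame_sat W obs V N y \<phi>}"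
    using Secret.IH by (auto simp: Fac_model)
  moreover have "facet ` U \<in> (`) facet ` N a x \<longleftrightarrow> U \<in> N a x" if "U \<subseteq> W" for U
  proof
    assume "facet ` U \<in> (`) facet ` N a x"
    then obtain U' where U': "facet ` U = facet ` U'" "U' \<in> N a x" by (rule imageE)
    then show "U \<in> N a x"
      using that N_subset[OF Secret.prems] inj_on_image_eq_iff[OF inj_on_facet, of U U'] by simp
  qed (rule imageI)
  ultimately show ?case
    using Secret by (simp add: Fac_model indist_def vertex_of_facet nbh_obs)
qed auto

end

section \<open>Maximal consistent sets\<close>

text \<open>Necessitation and replacement of equivalents act on theorems only, never on hypotheses.
  This is what makes the deduction theorem hold.\<close>

inductive derives :: "('a, 'p) form set \<Rightarrow> ('a, 'p) form \<Rightarrow> bool" for \<Gamma> where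
  SSL: "SSL \<phi> \<Longrightarrow> derives \<Gamma> \<phi>"
| Hyp: "\<phi> \<in> \<Gamma> \<Longrightarrow> derives \<Gamma> \<phi>"
| MP: "derives \<Gamma> \<phi> \<Longrightarrow> derives \<Gamma> (Imp \<phi> \<psi>) \<Longrightarrow> derives \<Gamma> \<psi>"

lemma derives_taut: "(\<And>h. bool_eval h \<phi>) \<Longrightarrow> derives \<Gamma> \<phi>"
  by (simp add: derives.SSL SSL.Taut tautology_def)

lemma derives_empty: "derives {} \<phi> \<Longrightarrow> SSL \<phi>"
  by (induction rule: derives.induct) (blast intro: SSL.MP)+

lemma derives_mono: "derives \<Gamma> \<phi> \<Longrightarrow> \<Gamma> \<subseteq> \<Delta> \<Longrightarrow> derives \<Delta> \<phi>"
  by (induction rule: derives.induct) (blast intro: derives.intros)+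

lemma derives_finite: "derives \<Gamma> \<phi> \<Longrightarrow> \<exists>\<Delta>\<subseteq>\<Gamma>. finite \<Delta> \<and> derives \<Delta> \<phi>"
proof (induction rule: derives.induct)
  case (SSL \<phi>)
  then show ?case by (auto intro: derives.SSL)
next
  case (Hyp \<phi>)
  then show ?case by (intro exI[of _ "{\<phi>}"]) (auto intro: derives.Hyp)
next
  case (MP \<phi> \<psi>)
  then obtain \<Delta> \<Delta>' where "\<Delta> \<subseteq> \<Gamma>" "finite \<Delta>" "derives \<Delta> \<phi>"
    "\<Delta>' \<subseteq> \<Gamma>" "finite \<Delta>'" "derives \<Delta>' (Imp \<phi> \<psi>)"
    by blast
  moreover from this have "derives (\<Delta> \<union> \<Delta>') \<psi>"
    by (meson derives.MP derives_mono Un_upper1 Un_upper2)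
  ultimately show ?case
    by (intro exI[of _ "\<Delta> \<union> \<Delta>'"]) auto
qed

lemma deduction: "derives (insert \<chi> \<Gamma>) \<phi> \<Longrightarrow> derives \<Gamma> (Imp \<chi> \<phi>)"
proof (induction rule: derives.induct)
  case (SSL \<phi>)
  show ?case
    by (rule derives.MP[OF derives.SSL[OF SSL]]) (auto intro: derives_taut)
next
  case (Hyp \<phi>)
  show ?case
  proof (cases "\<phi> = \<chi>")
    case True
    then show ?thesis by (auto intro: derives_taut)
  next
    case False
    then have "derives \<Gamma> \<phi>" using Hyp by (auto intro: derives.Hyp)
    then show ?thesis by (rule derives.MP) (auto intro: derives_taut)
  qed
next
  case (MP \<phi> \<psi>)
  have "derives \<Gamma> (Imp (Imp \<chi> \<phi>) (Imp (Imp \<chi> (Imp \<phi> \<psi>)) (Imp \<chi> \<psi>)))"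
    by (auto intro: derives_taut)
  then show ?case
    using MP.IH derives.MP by blast
qed

text \<open>Deductive closure together with negation completeness; the second condition already
  excludes containing both a formula and its negation.\<close>

definition mcs :: "('a, 'p) form set \<Rightarrow> bool" where
  "mcs \<Gamma> \<longleftrightarrow> (\<forall>\<phi>. derives \<Gamma> \<phi> \<longrightarrow> \<phi> \<in> \<Gamma>) \<and> (\<forall>\<phi>. Neg \<phi> \<in> \<Gamma> \<longleftrightarrow> \<phi> \<notin> \<Gamma>)"

text \<open>Zorn's lemma gives a set maximal among the extensions of \<Gamma> that do not derive
  \<phi>. Chains have upper bounds because a derivation uses finitely many hypotheses.\<close>

lemma lindenbaum:
  assumes "\<not> derives \<Gamma> \<phi>"
  obtains \<Delta> where "mcs \<Delta>" "\<Gamma> \<subseteq> \<Delta>" "\<phi> \<notin> \<Delta>"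
proof -
  let ?P = "{\<Delta>. \<Gamma> \<subseteq> \<Delta> \<and> \<not> derives \<Delta> \<phi>}"
  have "\<exists>\<Delta>\<in>?P. \<forall>X\<in>?P. \<Delta> \<subseteq> X \<longrightarrow> X = \<Delta>"
  proof (rule subset_Zorn_nonempty)
    show "?P \<noteq> {}" using assms by blast
  next
    fix C assume C: "C \<noteq> {}" "subset.chain ?P C"
    have "\<not> derives (\<Union>C) \<phi>"
    proof
      assume "derives (\<Union>C) \<phi>"
      then obtain \<Delta> where \<Delta>: "\<Delta> \<subseteq> \<Union>C" "finite \<Delta>" "derives \<Delta> \<phi>"
        using derives_finite by blast
      then obtain B where "B \<in> C" "\<Delta> \<subseteq> B"
        using C finite_subset_Union_chain by metis
      then have "derives B \<phi>"
        using derives_mono \<Delta>(3) by blast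
      then show False
        using C(2) \<open>B \<in> C\<close> unfolding subset.chain_def by blast
    qed
    then show "\<Union>C \<in> ?P"
      using C unfolding subset.chain_def by blast
  qed
  then obtain \<Delta> where "\<Delta> \<in> ?P" and max: "\<forall>X\<in>?P. \<Delta> \<subseteq> X \<longrightarrow> X = \<Delta>"
    by (rule bexE)
  then have \<Delta>: "\<Gamma> \<subseteq> \<Delta>" "\<not> derives \<Delta> \<phi>"
    by simp_all
  \<comment> \<open>By maximality, adding any new formula makes \<phi> derivable. Closure and
    completeness of \<Delta> both follow from this.\<close>
  have imp: "derives \<Delta> (Imp \<chi> \<phi>)" if "\<chi> \<notin> \<Delta>" for \<chi>
  proof (rule deduction, rule ccontr)
    assume "\<not> derives (insert \<chi> \<Delta>) \<phi>"
    then have "insert \<chi> \<Delta> = \<Delta>"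
      using max \<Delta>(1) by (simp add: subset_insertI subset_insertI2)
    then show False
      using that by blast
  qed
  have closed: "\<chi> \<in> \<Delta>" if "derives \<Delta> \<chi>" for \<chi>
    using that imp \<Delta>(2) derives.MP by blast
  have "\<not> (\<chi> \<in> \<Delta> \<and> Neg \<chi> \<in> \<Delta>)" for \<chi>
  proof
    assume "\<chi> \<in> \<Delta> \<and> Neg \<chi> \<in> \<Delta>"
    moreover have "derives \<Delta> (Imp \<chi> (Imp (Neg \<chi>) \<phi>))"
      by (auto intro: derives_taut)
    ultimately show False
      using \<Delta>(2) derives.MP derives.Hyp by blast
  qed
  moreover have "\<chi> \<in> \<Delta> \<or> Neg \<chi> \<in> \<Delta>" for \<chi>
  proof (rule ccontr)
    assume "\<not> ?thesis"
    then have "derives \<Delta> (Imp \<chi> \<phi>)" "derives \<Delta> (Imp (Neg \<chi>) \<phi>)"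
      using imp by auto
    moreover have "derives \<Delta> (Imp (Imp \<chi> \<phi>) (Imp (Imp (Neg \<chi>) \<phi>) \<phi>))"
      by (auto intro: derives_taut)
    ultimately show False
      using \<Delta>(2) derives.MP by blast
  qed
  ultimately have "mcs \<Delta>"
    using closed unfolding mcs_def by blast
  moreover have "\<phi> \<notin> \<Delta>"
    using \<Delta>(2) derives.Hyp by blast
  ultimately show thesis
    using that \<Delta>(1) by blast
qed

lemma mcs_derives: "mcs \<Gamma> \<Longrightarrow> derives \<Gamma> \<phi> \<Longrightarrow> \<phi> \<in> \<Gamma>"
  unfolding mcs_def by blast

lemma mcs_Neg: "mcs \<Gamma> \<Longrightarrow> Neg \<phi> \<in> \<Gamma> \<longleftrightarrow> \<phi> \<notin> \<Gamma>"
  unfolding mcs_def by blast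

lemma mcs_Conj:
  assumes "mcs \<Gamma>"
  shows "Conj \<phi> \<psi> \<in> \<Gamma> \<longleftrightarrow> \<phi> \<in> \<Gamma> \<and> \<psi> \<in> \<Gamma>"
proof -
  have "derives \<Gamma> (Imp (Conj \<phi> \<psi>) \<phi>)" "derives \<Gamma> (Imp (Conj \<phi> \<psi>) \<psi>)"
    "derives \<Gamma> (Imp \<phi> (Imp \<psi> (Conj \<phi> \<psi>)))"
    by (auto intro: derives_taut)
  then show ?thesis
    using mcs_derives[OF assms] derives.MP derives.Hyp by meson
qed

lemma mcs_Imp: "mcs \<Gamma> \<Longrightarrow> Imp \<phi> \<psi> \<in> \<Gamma> \<longleftrightarrow> (\<phi> \<in> \<Gamma> \<longrightarrow> \<psi> \<in> \<Gamma>)"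
  by (simp add: mcs_Neg mcs_Conj)

lemma mcs_SSL_Imp: "mcs \<Gamma> \<Longrightarrow> SSL (Imp \<phi> \<psi>) \<Longrightarrow> \<phi> \<in> \<Gamma> \<Longrightarrow> \<psi> \<in> \<Gamma>"
  using mcs_derives[of \<Gamma> "Imp \<phi> \<psi>"] by (simp add: derives.SSL mcs_Imp)

lemma SSL_if_in_all_mcs:
  assumes "\<And>\<Gamma>. mcs \<Gamma> \<Longrightarrow> \<phi> \<in> \<Gamma>"
  shows "SSL \<phi>"
proof (rule ccontr)
  assume "\<not> SSL \<phi>"
  then have "\<not> derives {} \<phi>"
    using derives_empty by blast
  then show False
    by (rule lindenbaum) (use assms in blast)
qed

text \<open>The derivation is replayed under \<open>Know a\<close>: theorems by necessitation, modus
  ponens by axiom K.\<close>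

lemma mcs_Know_derives:
  assumes "mcs \<Gamma>" "derives {\<chi>. Know a \<chi> \<in> \<Gamma>} \<psi>"
  shows "Know a \<psi> \<in> \<Gamma>"
  using assms(2)
proof (induction rule: derives.induct)
  case (SSL \<phi>)
  then show ?case
    by (intro mcs_derives[OF assms(1)] derives.SSL SSL.Nec)
next
  case (MP \<phi> \<psi>)
  then show ?case
    using mcs_SSL_Imp[OF assms(1) SSL.AxK[of a \<phi> \<psi>]] by (simp add: mcs_Imp assms(1))
qed simp

text \<open>\<Delta> is a Lindenbaum extension of what \<open>a\<close> knows in \<Gamma>. Axioms 4
  and 5 make the two sets agree on the knowledge of \<open>a\<close>.\<close>

lemma mcs_successor:
  assumes \<Gamma>: "mcs \<Gamma>" and "Know a \<psi> \<notin> \<Gamma>"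
  obtains \<Delta> where "mcs \<Delta>" "\<psi> \<notin> \<Delta>"
    "\<And>\<chi>. Know a \<chi> \<in> \<Delta> \<longleftrightarrow> Know a \<chi> \<in> \<Gamma>"
    "\<And>\<chi>. Secret a \<chi> \<in> \<Delta> \<longleftrightarrow> Secret a \<chi> \<in> \<Gamma>"
proof -
  have "\<not> derives {\<chi>. Know a \<chi> \<in> \<Gamma>} \<psi>"
    using mcs_Know_derives[OF \<Gamma>] assms(2) by blast
  then obtain \<Delta> where \<Delta>: "mcs \<Delta>" "\<psi> \<notin> \<Delta>" and sub: "{\<chi>. Know a \<chi> \<in> \<Gamma>} \<subseteq> \<Delta>"
    by (rule lindenbaum)
  have know: "Know a \<chi> \<in> \<Delta> \<longleftrightarrow> Know a \<chi> \<in> \<Gamma>" for \<chi>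
  proof
    assume "Know a \<chi> \<in> \<Gamma>"
    then show "Know a \<chi> \<in> \<Delta>"
      using mcs_SSL_Imp[OF \<Gamma> SSL.Ax4] sub by blast
  next
    assume "Know a \<chi> \<in> \<Delta>"
    then show "Know a \<chi> \<in> \<Gamma>"
      using mcs_SSL_Imp[OF \<Gamma> SSL.Ax5] sub mcs_Neg[OF \<Gamma>] mcs_Neg[OF \<Delta>(1)] by blast
  qed
  \<comment> \<open>S4 and T make a secret equivalent to a piece of knowledge, so agreement on
    \<open>Know a\<close> carries over to \<open>Secret a\<close>.\<close>
  moreover have "Secret a \<chi> \<in> \<Theta> \<longleftrightarrow> Know a (Secret a \<chi>) \<in> \<Theta>" if "mcs \<Theta>" for \<Theta> \<chi>
    using mcs_SSL_Imp[OF that SSL.AxS4] mcs_SSL_Imp[OF that SSL.AxT] by blast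
  ultimately have "Secret a \<chi> \<in> \<Delta> \<longleftrightarrow> Secret a \<chi> \<in> \<Gamma>" for \<chi>
    using \<Gamma> \<Delta>(1) by blast
  then show thesis
    using that \<Delta> know by blast
qed

section \<open>The filtered canonical frame\<close>

text \<open>Subformulas, and below \<open>Secret a \<phi>\<close> also \<open>Know b \<phi>\<close>
  for every agent \<open>b\<close>: S1 needs the case \<open>b = a\<close>, S2 the others. With
  finitely many agents the set stays finite.\<close>

primrec closure :: "('a, 'p) form \<Rightarrow> ('a, 'p) form set" where
  "closure (Atom p) = {Atom p}"
| "closure (Neg \<phi>) = insert (Neg \<phi>) (closure \<phi>)"
| "closure (Conj \<phi> \<psi>) = insert (Conj \<phi> \<psi>) (closure \<phi> \<union> closure \<psi>)"
| "closure (Know a \<phi>) = insert (Know a \<phi>) (closure \<phi>)"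
| "closure (Secret a \<phi>) = insert (Secret a \<phi>) (range (\<lambda>b. Know b \<phi>) \<union> closure \<phi>)"

lemma finite_closure: "finite (closure (\<phi> :: ('a::finite, 'p) form))"
  by (induction \<phi>) auto

lemma closure_refl: "\<phi> \<in> closure \<phi>"
  by (cases \<phi>) auto

lemma closure_Neg: "Neg \<psi> \<in> closure \<phi> \<Longrightarrow> \<psi> \<in> closure \<phi>"
  by (induction \<phi>) (auto intro: closure_refl)

lemma closure_Conj: "Conj \<psi> \<chi> \<in> closure \<phi> \<Longrightarrow> \<psi> \<in> closure \<phi> \<and> \<chi> \<in> closure \<phi>"
  by (induction \<phi>) (auto intro: closure_refl)

lemma closure_Know: "Know a \<psi> \<in> closure \<phi> \<Longrightarrow> \<psi> \<in> closure \<phi>"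
  by (induction \<phi>) (auto intro: closure_refl)

lemma closure_Secret: "Secret a \<psi> \<in> closure \<phi> \<Longrightarrow> \<psi> \<in> closure \<phi>"
  by (induction \<phi>) (auto intro: closure_refl)

lemma closure_Secret_Know: "Secret a \<psi> \<in> closure \<phi> \<Longrightarrow> Know b \<psi> \<in> closure \<phi>"
  by (induction \<phi>) auto

definition traces :: "('a, 'p) form \<Rightarrow> ('a, 'p) form set set" where
  "traces \<phi> = {\<Gamma> \<inter> closure \<phi> |\<Gamma>. mcs \<Gamma>}"

lemma traces_subset: "traces \<phi> \<subseteq> Pow (closure \<phi>)"
  unfolding traces_def by blast

definition view :: "'a \<Rightarrow> ('a, 'p) form set \<Rightarrow> ('a, 'p) form set" where
  "view a w = {\<chi> \<in> w. \<exists>\<psi>. \<chi> = Know a \<psi> \<or> \<chi> = Secret a \<psi>}"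

lemma view_Know: "view a w = view a u \<Longrightarrow> Know a \<psi> \<in> w \<longleftrightarrow> Know a \<psi> \<in> u"
  unfolding view_def by blast

lemma view_Secret: "view a w = view a u \<Longrightarrow> Secret a \<psi> \<in> w \<longleftrightarrow> Secret a \<psi> \<in> u"
  unfolding view_def by blast

text \<open>Forwards, equal views transfer the formula and T removes the modality. Backwards, the
  trace of the set given by \<open>mcs_successor\<close> has the same view and refutes
  \<psi>.\<close>

lemma traces_Know:
  assumes "w \<in> traces \<phi>" "Know a \<psi> \<in> closure \<phi>"
  shows "Know a \<psi> \<in> w \<longleftrightarrow> (\<forall>u\<in>traces \<phi>. view a w = view a u \<longrightarrow> \<psi> \<in> u)"
proof (intro iffI ballI impI)
  fix u assume "Know a \<psi> \<in> w" and u: "u \<in> traces \<phi>" "view a w = view a u"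
  then have "Know a \<psi> \<in> u"
    using view_Know by metis
  then show "\<psi> \<in> u"
    using u(1) closure_Know[OF assms(2)] mcs_SSL_Imp[OF _ SSL.AxT, of _ a \<psi>]
    by (auto simp: traces_def)
next
  assume all: "\<forall>u\<in>traces \<phi>. view a w = view a u \<longrightarrow> \<psi> \<in> u"
  obtain \<Gamma> where \<Gamma>: "mcs \<Gamma>" "w = \<Gamma> \<inter> closure \<phi>"
    using assms(1) unfolding traces_def by blast
  have "Know a \<psi> \<in> \<Gamma>"
  proof (rule ccontr)
    assume "Know a \<psi> \<notin> \<Gamma>"
    then obtain \<Delta> where \<Delta>: "mcs \<Delta>" "\<psi> \<notin> \<Delta>"
      "\<And>\<chi>. Know a \<chi> \<in> \<Delta> \<longleftrightarrow> Know a \<chi> \<in> \<Gamma>"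
      "\<And>\<chi>. Secret a \<chi> \<in> \<Delta> \<longleftrightarrow> Secret a \<chi> \<in> \<Gamma>"
      by (rule mcs_successor[OF \<Gamma>(1)]) (rule that)
    have "view a w = view a (\<Delta> \<inter> closure \<phi>)"
      unfolding \<Gamma>(2) view_def using \<Delta>(3,4) by blast
    then show False
      using all \<Delta>(1,2) unfolding traces_def by blast
  qed
  then show "Know a \<psi> \<in> w"
    using \<Gamma>(2) assms(2) by blast
qed

lemma traces_Secret_Know: "w \<in> traces \<phi> \<Longrightarrow> Secret a \<psi> \<in> w \<Longrightarrow> Know a \<psi> \<in> w"
  using closure_Secret_Know[of a \<psi> \<phi> a] mcs_SSL_Imp[OF _ SSL.AxS1, of _ a \<psi>] by (auto simp: traces_def)

lemma traces_Secret_not_Know: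
  "w \<in> traces \<phi> \<Longrightarrow> Secret a \<psi> \<in> w \<Longrightarrow> a \<noteq> b \<Longrightarrow> Know b \<psi> \<notin> w"
  using mcs_SSL_Imp[OF _ SSL.AxS2, of _ a b \<psi>] by (auto simp: traces_def mcs_Neg)

text \<open>Every maximal consistent set has a trace, so formulas of the closure that agree on all
  traces are provably equivalent, and rule RE applies. Hence secrecy depends only on the truth
  set.\<close>

lemma traces_Secret_cong:
  assumes "w \<in> traces \<phi>" "Secret a \<psi> \<in> w" "Secret a \<chi> \<in> closure \<phi>"
    and eq: "\<And>u. u \<in> traces \<phi> \<Longrightarrow> \<psi> \<in> u \<longleftrightarrow> \<chi> \<in> u"
  shows "Secret a \<chi> \<in> w"
proof -
  obtain \<Gamma> where \<Gamma>: "mcs \<Gamma>" "w = \<Gamma> \<inter> closure \<phi>"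
    using assms(1) unfolding traces_def by blast
  have cl: "\<psi> \<in> closure \<phi>" "\<chi> \<in> closure \<phi>"
    using closure_Secret[of a] assms(2,3) \<Gamma>(2) by auto
  have "SSL (Iff \<psi> \<chi>)"
  proof (rule SSL_if_in_all_mcs)
    fix \<Delta> :: "('a, 'b) form set" assume \<Delta>: "mcs \<Delta>"
    then have "\<Delta> \<inter> closure \<phi> \<in> traces \<phi>"
      unfolding traces_def by blast
    from eq[OF this] have "\<psi> \<in> \<Delta> \<longleftrightarrow> \<chi> \<in> \<Delta>"
      using cl by simp
    then show "Iff \<psi> \<chi> \<in> \<Delta>"
      by (simp add: mcs_Conj mcs_Neg \<Delta>)
  qed
  then have "Iff (Secret a \<psi>) (Secret a \<chi>) \<in> \<Gamma>"
    by (intro mcs_derives[OF \<Gamma>(1)] derives.SSL SSL.RE)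
  then show ?thesis
    using assms(2,3) \<Gamma> by (simp add: mcs_Conj mcs_Neg)
qed

section \<open>Completeness\<close>

text \<open>\<open>W\<close> is any cover of the traces whose observations separate worlds. The last
  two assumptions make \<open>trace\<close> a bounded morphism for every agent, which keeps the
  canonical argument independent of how the copies are built.\<close>

lemma completeness_separated:
  fixes \<phi> :: "('a::finite, 'p) form"
    and W :: "'w set" and trace :: "'w \<Rightarrow> ('a, 'p) form set"
    and obs :: "'a \<Rightarrow> 'w \<Rightarrow> 'v"
  assumes valid: "\<And>M :: ('v, 'a, 'p) secrecy_structure.
      secrecy_model M \<Longrightarrow> \<forall>X\<in>Fac M. sat M X \<phi>"
    and traces: "trace ` W = traces \<phi>"
    and obs_agent: "\<And>x y a b. \<lbrakk>x \<in> W; y \<in> W; obs a x = obs b y\<rbrakk> \<Longrightarrow> a = b"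
    and obs_separates: "\<And>x y. \<lbrakk>x \<in> W; y \<in> W; \<And>a. obs a x = obs a y\<rbrakk> \<Longrightarrow> x = y"
    and obs_view: "\<And>x y a. \<lbrakk>x \<in> W; y \<in> W; obs a x = obs a y\<rbrakk> \<Longrightarrow>
      view a (trace x) = view a (trace y)"
    and obs_lift: "\<And>x u a. \<lbrakk>x \<in> W; u \<in> traces \<phi>; view a (trace x) = view a u\<rbrakk> \<Longrightarrow>
      \<exists>y\<in>W. obs a x = obs a y \<and> trace y = u"
  shows "SSL \<phi>"
proof (rule ccontr)
  assume "\<not> SSL \<phi>"
  then obtain \<Gamma>\<^sub>0 where \<Gamma>\<^sub>0: "mcs \<Gamma>\<^sub>0" "\<phi> \<notin> \<Gamma>\<^sub>0"
    using SSL_if_in_all_mcs by blast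
  then have "\<Gamma>\<^sub>0 \<inter> closure \<phi> \<in> trace ` W"
    unfolding traces traces_def by blast
  then obtain x\<^sub>0 where x\<^sub>0: "x\<^sub>0 \<in> W" "trace x\<^sub>0 = \<Gamma>\<^sub>0 \<inter> closure \<phi>"
    by force
  define V where "V x = {p. Atom p \<in> trace x}" for x
  \<comment> \<open>Truth sets are taken in the cover, so all copies of a trace enter a
    neighbourhood together.\<close>
  define N where "N a x = {{y \<in> W. \<psi> \<in> trace y} |\<psi>. Secret a \<psi> \<in> trace x}" for a x
  have trace_in: "trace x \<in> traces \<phi>" if "x \<in> W" for x
    using that traces by blast
  have trace_Know: "Know a \<psi> \<in> trace x \<longleftrightarrow> (\<forall>y\<in>W. obs a x = obs a y \<longrightarrow> \<psi> \<in> trace y)"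
    if "x \<in> W" "Know a \<psi> \<in> closure \<phi>" for a \<psi> x
    unfolding traces_Know[OF trace_in[OF that(1)] that(2)]
  proof (intro iffI ballI impI)
    fix y assume "\<forall>u\<in>traces \<phi>. view a (trace x) = view a u \<longrightarrow> \<psi> \<in> u"
      and "y \<in> W" "obs a x = obs a y"
    then show "\<psi> \<in> trace y"
      using trace_in obs_view[OF that(1)] by simp
  next
    fix u assume all: "\<forall>y\<in>W. obs a x = obs a y \<longrightarrow> \<psi> \<in> trace y"
      and "u \<in> traces \<phi>" "view a (trace x) = view a u"
    then obtain y where "y \<in> W" "obs a x = obs a y" "trace y = u"
      using obs_lift[OF \<open>x \<in> W\<close>] by blast
    then show "\<psi> \<in> u"
      using all by blast
  qed
  interpret secrecy_frame W obs V N
  proof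
    show "W \<noteq> {}" using x\<^sub>0 by blast
  next
    fix x U a assume "x \<in> W" "U \<in> N a x"
    then show "U \<subseteq> W" unfolding N_def by blast
  next
    fix x y a assume "x \<in> W" "y \<in> W" "obs a x = obs a y"
    from view_Secret[OF obs_view[OF this]] show "N a x = N a y"
      unfolding N_def by simp
  next
    fix x U a and b :: 'a assume *: "x \<in> W" "U \<in> N a x" "b \<noteq> a"
    then obtain \<psi> where \<psi>: "U = {y \<in> W. \<psi> \<in> trace y}" "Secret a \<psi> \<in> trace x"
      unfolding N_def by blast
    \<comment> \<open>\<open>Know b \<psi>\<close> lies in the closure but S2 keeps it out of the
      trace, so \<open>trace_Know\<close> supplies a world that \<open>b\<close> cannot distinguish
      from \<open>x\<close> and where \<psi> fails.\<close>
    then have "Secret a \<psi> \<in> closure \<phi>"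
      using trace_in[OF *(1)] traces_subset by blast
    then have "Know b \<psi> \<in> closure \<phi>"
      by (rule closure_Secret_Know)
    moreover have "Know b \<psi> \<notin> trace x"
      using traces_Secret_not_Know[OF trace_in[OF *(1)] \<psi>(2)] *(3) by simp
    ultimately show "\<exists>y\<in>W. obs b x = obs b y \<and> y \<notin> U"
      using trace_Know[OF *(1)] \<psi>(1) by blast
  qed (use obs_agent obs_separates in blast)+
  have truth: "frame_sat W obs V N x \<psi> \<longleftrightarrow> \<psi> \<in> trace x" if "x \<in> W" "\<psi> \<in> closure \<phi>" for x \<psi>
    using that
  proof (induction \<psi> arbitrary: x)
    case (Atom p)
    then show ?case by (simp add: V_def)
  next
    case (Neg \<psi>)
    then show ?case
      using closure_Neg[OF Neg.prems(2)] trace_in[OF Neg.prems(1)]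
      by (auto simp: traces_def mcs_Neg)
  next
    case (Conj \<psi> \<chi>)
    then show ?case
      using closure_Conj[OF Conj.prems(2)] trace_in[OF Conj.prems(1)]
      by (auto simp: traces_def mcs_Conj)
  next
    case (Know a \<psi>)
    then show ?case
      using closure_Know[OF Know.prems(2)] trace_Know[OF Know.prems] by simp
  next
    case (Secret a \<psi>)
    have cl: "\<psi> \<in> closure \<phi>" "Know a \<psi> \<in> closure \<phi>"
      using closure_Secret closure_Secret_Know Secret.prems(2) by metis+
    have "frame_sat W obs V N x (Secret a \<psi>) \<longleftrightarrow>
        Know a \<psi> \<in> trace x \<and> {y \<in> W. \<psi> \<in> trace y} \<in> N a x"
      using Secret.IH cl trace_Know[OF Secret.prems(1) cl(2)] by (simp cong: conj_cong)
    also have "\<dots> \<longleftrightarrow> Secret a \<psi> \<in> trace x"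
    proof
      assume "Secret a \<psi> \<in> trace x"
      then show "Know a \<psi> \<in> trace x \<and> {y \<in> W. \<psi> \<in> trace y} \<in> N a x"
        using traces_Secret_Know[OF trace_in[OF Secret.prems(1)]] unfolding N_def by blast
    next
      \<comment> \<open>Membership in \<open>N\<close> only yields some secret \<chi> with the same
        truth set in \<open>W\<close>. Since \<open>trace\<close> maps onto the traces, \<psi> and
        \<chi> agree on all of them and the congruence lemma applies.\<close>
      assume "Know a \<psi> \<in> trace x \<and> {y \<in> W. \<psi> \<in> trace y} \<in> N a x"
      then obtain \<chi> where \<chi>: "Secret a \<chi> \<in> trace x"
        "{y \<in> W. \<psi> \<in> trace y} = {y \<in> W. \<chi> \<in> trace y}"
        unfolding N_def by blast
      show "Secret a \<psi> \<in> trace x"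
      proof (rule traces_Secret_cong[OF trace_in[OF Secret.prems(1)] \<chi>(1) Secret.prems(2)])
        fix u assume "u \<in> traces \<phi>"
        then obtain y where "y \<in> W" "u = trace y"
          unfolding traces[symmetric] by (rule imageE)
        then show "\<chi> \<in> u \<longleftrightarrow> \<psi> \<in> u"
          using eqset_imp_iff[OF \<chi>(2), of y] by simp
      qed
    qed
    finally show ?case .
  qed
  have "facet x\<^sub>0 \<in> Fac model"
    using x\<^sub>0(1) by (simp add: Fac_model)
  then have "frame_sat W obs V N x\<^sub>0 \<phi>"
    using valid secrecy_model sat_model x\<^sub>0(1) by blast
  then show False
    using truth[OF x\<^sub>0(1) closure_refl] x\<^sub>0(2) \<Gamma>\<^sub>0(2) by blast
qed

text \<open>Validity is assumed over one arbitrary infinite vertex type. This suffices because the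
  countermodel has countably many vertices, which can be coded into that type.\<close>

theorem theorem5p23:
  fixes \<phi> :: "('a::finite, 'p::countable) form"
  assumes "CARD('a) \<ge> 2"
    and "infinite (UNIV :: 'v set)"
    and "\<forall>M :: ('v, 'a, 'p) secrecy_structure.
           secrecy_model M \<longrightarrow> (\<forall>X\<in>Fac M. sat M X \<phi>)"
  shows "SSL \<phi>"
proof -
  have fin: "finite (traces \<phi>)"
    using finite_subset[OF traces_subset] finite_closure by blast
  obtain c d :: 'a where "c \<noteq> d"
    using assms(1) by (metis One_nat_def card_le_Suc0_iff_eq
        finite not_less_eq_eq numeral_2_eq_2)
  obtain i :: "('a, 'p) form set \<Rightarrow> int" where i: "inj_on i (traces \<phi>)"
    using inj_on_of_nat[where 'a = int] inj_on_to_nat_on[OF countable_finite[OF fin]]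
      comp_inj_on by blast
  \<comment> \<open>A vertex is coded by its agent, the view of that agent and the observed counter.
    Tagging by the agent gives \<open>obs_agent\<close>; views are subsets of a finite closure, so
    the labels are countable.\<close>
  let ?labels = "(UNIV :: 'a set) \<times> Pow (closure \<phi>) \<times> (UNIV :: int set)"
  have "countable ?labels"
    by (intro countable_SIGMA countableI_type) (simp add: countable_finite finite_closure)
  moreover obtain f :: "nat \<Rightarrow> 'v" where "inj f"
    using assms(2) infinite_countable_subset by blast
  ultimately obtain e :: "'a \<times> ('a, 'p) form set \<times> int \<Rightarrow> 'v" where e: "inj_on e ?labels"
    using that comp_inj_on[OF inj_on_to_nat_on inj_on_subset] subset_UNIV by metis
  \<comment> \<open>Only \<open>d\<close> sees the counter displaced by the index of the trace;
    \<open>c\<close> and any further agents see it plainly.\<close>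
  define shift where "shift a w = (if a = d then i w else 0)" for a w
  define obs where "obs a x = e (a, view a (fst x), snd x + shift a (fst x))" for a x
  define W where "W = traces \<phi> \<times> (UNIV :: int set)"
  have obs_eq: "obs a x = obs b y \<longleftrightarrow> a = b \<and> view a (fst x) = view b (fst y) \<and>
      snd x + shift a (fst x) = snd y + shift b (fst y)"
    if "x \<in> W" "y \<in> W" for a b x y
  proof -
    have "view a (fst x) \<subseteq> closure \<phi>" "view b (fst y) \<subseteq> closure \<phi>"
      using that by (auto simp: W_def view_def traces_def)
    then show ?thesis
      unfolding obs_def by (subst inj_on_eq_iff[OF e]) auto
  qed
  show ?thesis
  proof (rule completeness_separated[where trace = fst and W = W and obs = obs])
    show "\<forall>X\<in>Fac M. sat M X \<phi>" if "secrecy_model M" for M :: "('v, 'a, 'p) secrecy_structure"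
      using assms(3) that by blast
    show "fst ` W = traces \<phi>"
      unfolding W_def by simp
  next
    fix x y assume xy: "x \<in> W" "y \<in> W" and "\<And>a. obs a x = obs a y"
    \<comment> \<open>Agent \<open>c\<close> reveals the counter; subtracting it from what
      \<open>d\<close> sees reveals the index of the trace.\<close>
    then have "snd x = snd y" "i (fst x) = i (fst y)"
      using obs_eq[OF xy, of c c] obs_eq[OF xy, of d d] \<open>c \<noteq> d\<close> by (auto simp: shift_def)
    then show "x = y"
      using xy i unfolding W_def by (auto dest: inj_onD)
  next
    fix x u a assume *: "x \<in> W" "u \<in> traces \<phi>" "view a (fst x) = view a u"
    \<comment> \<open>The counter of the copy compensates for the change of shift, so
      \<open>a\<close> observes the same value. It may become negative, hence integers.\<close>
    let ?y = "(u, snd x + shift a (fst x) - shift a u)"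
    have "?y \<in> W" using *(2) unfolding W_def by simp
    then show "\<exists>y\<in>W. obs a x = obs a y \<and> fst y = u"
      using obs_eq[OF *(1)] *(3) by (intro bexI[of _ ?y]) auto
  qed (use obs_eq in blast)+
qed

end
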